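(* Let $\Gamma(\mathbb{Z}_n)$ be the comaximal graph of $\mathbb{Z}_n$. Then the following hold. (i) If $n=p^m$, where $p$ is a prime and $m\ge 2$ is a positive integer, then the independent domination polynomial of $\Gamma(\mathbb{Z}_n)$ is $$D_i(\Gamma(\mathbb{Z}_n),x)=(p^m-p^{m-1})x+x^{p^{m-1}}.$$ (ii) If $n=p^{n_1}q^{n_2}$, where $p<q$ are primes and $n_1,n_2$ are positive integers, then the independent domination polynomial of $\Gamma(\mathbb{Z}_n)$ is $$D_i(\Gamma(\mathbb{Z}_n),x)=\phi(n)x+x^{p^{n_1}q^{n_2-1}}+x^{p^{n_1-1}q^{n_2}}.$$ (iii) If $n=p^{n_1}q^{n_2}r^{n_3}$, where $p,q,r$ are distinct primes and $n_1,n_2,n_3$ are positive integers, then the independent domination polynomial of $\Gamma(\mathbb{Z}_n)$ is $$D_i(\Gamma(\mathbb{Z}_n),x)=\phi(n)x+x^{p^{n_1-1}q^{n_2-1}r^{n_3-1}}\Big(x^{p+q+r-2}+x^{pq}+x^{pr}+x^{qr}\Big).$$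
   Context: For a commutative ring $R$ with identity $1\ne 0$, the comaximal graph $\Gamma(R)$ is the simple graph with vertex set $R$ in which two distinct vertices $a,b$ are adjacent if and only if $aR+bR=R$. $\mathbb{Z}_n$ is the ring of integers modulo $n$, and $\phi$ is Euler's totient function. A non-empty set $S\subseteq V(G)$ is dominating if every vertex of $V(G)\setminus S$ is adjacent to at least one vertex of $S$; it is independent if its elements are pairwise non-adjacent; it is an independent dominating set if it is both. The independent domination polynomial is $D_i(G,x)=\sum_k d_i(G,k)x^k$, where $d_i(G,k)$ is the number of independent dominating sets of $G$ of cardinality $k$, and $k$ runs from the minimum size of an independent dominating set to the independence number (the largest size of an independent set).
   Formalization: In (iii), with N = p^{n_1-1}q^{n_2-1}r^{n_3-1}, the printed factor x^N times the bracket is false (e.g. n=30); proved instead is φ(n)x + x^{N(p+q+r-2)} + x^{Npq} + x^{Npr} + x^{Nqr}, with N multiplying the exponents. *)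

theory Defs
  imports
    "HOL-Number_Theory.Residues"
    "HOL-Computational_Algebra.Polynomial"
    "Graph_Theory.Pair_Digraph"
begin

text \<open>
  A simple graph is a digraph in the sense of the locale \<^locale>\<open>pair_graph\<close>: finite, loop-free, without
  parallel arcs and symmetric, an edge between u and v being represented by both arcs
  (u, v) and (v, u).
\<close>

definition comaximal_graph :: "('a, 'b) ring_scheme \<Rightarrow> 'a pair_pre_digraph" where
  "comaximal_graph R =
     \<lparr> pverts = carrier R,
       parcs = {(a, b). a \<in> carrier R \<and> b \<in> carrier R \<and> a \<noteq> b \<and>
                 PIdl\<^bsub>R\<^esub> a <+>\<^bsub>R\<^esub> PIdl\<^bsub>R\<^esub> b = carrier R} \<rparr>"

lemma pair_graph_comaximal_graph:
  assumes "cring R" "finite (carrier R)"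
  shows "pair_graph (comaximal_graph R)"
proof -
  interpret cring R by fact
  have comm: "PIdl\<^bsub>R\<^esub> a <+>\<^bsub>R\<^esub> PIdl\<^bsub>R\<^esub> b = PIdl\<^bsub>R\<^esub> b <+>\<^bsub>R\<^esub> PIdl\<^bsub>R\<^esub> a"
    if "a \<in> carrier R" "b \<in> carrier R" for a b
    by (rule set_add_comm)
      (simp_all add: that cgenideal_ideal additive_subgroup.a_subset ideal.axioms(1))
  have verts: "pverts (comaximal_graph R) = carrier R"
    by (simp add: comaximal_graph_def)
  have arc_iff: "(a, b) \<in> parcs (comaximal_graph R) \<longleftrightarrow>
      a \<in> carrier R \<and> b \<in> carrier R \<and> a \<noteq> b \<and> PIdl\<^bsub>R\<^esub> a <+>\<^bsub>R\<^esub> PIdl\<^bsub>R\<^esub> b = carrier R" for a b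
    unfolding comaximal_graph_def pair_pre_digraph.simps by (simp only: mem_Collect_eq prod.case)
  have sub: "e \<in> carrier R \<times> carrier R" "fst e \<noteq> snd e"
    if "e \<in> parcs (comaximal_graph R)" for e
    using that arc_iff[of "fst e" "snd e"] unfolding prod.collapse mem_Times_iff by blast+
  have fin: "finite (parcs (comaximal_graph R))"
    by (rule finite_subset[of _ "carrier R \<times> carrier R"]) (blast intro: sub, simp add: assms(2))
  have sym: "sym (parcs (comaximal_graph R))"
  proof (rule symI)
    fix a b assume "(a, b) \<in> parcs (comaximal_graph R)"
    then have *: "a \<in> carrier R" "b \<in> carrier R" "a \<noteq> b"
        "PIdl\<^bsub>R\<^esub> a <+>\<^bsub>R\<^esub> PIdl\<^bsub>R\<^esub> b = carrier R"
      unfolding arc_iff by blast+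
    show "(b, a) \<in> parcs (comaximal_graph R)"
      unfolding arc_iff comm[OF *(2,1)] using * by blast
  qed
  show ?thesis
  proof
    fix e assume e: "e \<in> parcs (comaximal_graph R)"
    show "fst e \<in> pverts (comaximal_graph R)" "snd e \<in> pverts (comaximal_graph R)"
      using sub(1)[OF e] unfolding verts mem_Times_iff by blast+
    show "fst e \<noteq> snd e" by (rule sub(2)[OF e])
  next
    show "finite (pverts (comaximal_graph R))" unfolding verts by (rule assms(2))
  next
    show "finite (parcs (comaximal_graph R))" by (rule fin)
  next
    show "symmetric (with_proj (comaximal_graph R))"
      unfolding symmetric_def with_proj_simps by (rule sym)
  qed
qed

definition dominating_set :: "'a pair_pre_digraph \<Rightarrow> 'a set \<Rightarrow> bool" where
  "dominating_set G S \<longleftrightarrow>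
     S \<noteq> {} \<and> S \<subseteq> pverts G \<and> (\<forall>v \<in> pverts G - S. \<exists>s \<in> S. (v, s) \<in> parcs G)"

definition independent_set :: "'a pair_pre_digraph \<Rightarrow> 'a set \<Rightarrow> bool" where
  "independent_set G S \<longleftrightarrow>
     S \<subseteq> pverts G \<and> (\<forall>u \<in> S. \<forall>v \<in> S. (u, v) \<notin> parcs G)"

definition independent_dominating_set :: "'a pair_pre_digraph \<Rightarrow> 'a set \<Rightarrow> bool" where
  "independent_dominating_set G S \<longleftrightarrow> independent_set G S \<and> dominating_set G S"

definition independent_domination_number :: "'a pair_pre_digraph \<Rightarrow> nat" where
  "independent_domination_number G = Min {card S | S. independent_dominating_set G S}"

definition independence_number :: "'a pair_pre_digraph \<Rightarrow> nat" where
  "independence_number G = Max {card S | S. independent_set G S}"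

definition num_independent_dominating_sets :: "'a pair_pre_digraph \<Rightarrow> nat \<Rightarrow> nat" where
  "num_independent_dominating_sets G k =
     card {S. independent_dominating_set G S \<and> card S = k}"

definition independent_domination_poly :: "'a pair_pre_digraph \<Rightarrow> int poly" where
  "independent_domination_poly G =
     (\<Sum>k = independent_domination_number G..independence_number G.
        Polynomial.monom (int (num_independent_dominating_sets G k)) k)"

end

theory Submission
  imports Defs
begin

text \<open>
  Independent dominating sets are the non-empty maximal independent sets. A unit of the ring is adjacent
  to every other vertex, so it forms such a set by itself and lies in no other. Two distinct non-units are
  non-adjacent iff some prime divisor of n divides both, so the remaining sets correspond to maximal
  intersecting families of non-empty sets of prime divisors of n. For one or two primes these are the
  families of all sets containing a fixed prime; for three primes there is also the family of
  all sets with at least two elements.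
\<close>

section \<open>Independent domination polynomials of finite graphs\<close>

lemma independent_dominating_set_maximal:
  assumes "independent_dominating_set G S" "independent_set G T" "S \<subseteq> T"
  shows "S = T"
proof (rule ccontr)
  assume "S \<noteq> T"
  then obtain v where v: "v \<in> T" "v \<notin> S" using assms(3) by blast
  then have "v \<in> pverts G - S" using assms(2) by (auto simp: independent_set_def)
  then obtain s where "s \<in> S" "(v, s) \<in> parcs G"
    using assms(1) unfolding independent_dominating_set_def dominating_set_def by meson
  then show False using assms(2,3) v(1) unfolding independent_set_def by (meson subsetD)
qed

lemma of_nat_mult_monom: "of_nat m * Polynomial.monom 1 k = Polynomial.monom (int m) k"
  by (simp only: of_nat_poly mult_pCons_left mult_zero_left smult_monom) simp

text \<open>Grouping independent dominating sets by size turns one monomial per set into the counted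
  coefficients. The right-hand side has no summation bounds, so the independent domination and
  independence numbers never have to be computed.\<close>

lemma independent_domination_poly_eq_sum:
  assumes fin: "finite (pverts G)"
  shows "independent_domination_poly G =
    (\<Sum>S | independent_dominating_set G S. Polynomial.monom 1 (card S))"
proof -
  let ?D = "{S. independent_dominating_set G S}"
  let ?I = "{independent_domination_number G..independence_number G}"
  have subs: "?D \<subseteq> Pow (pverts G)" "{S. independent_set G S} \<subseteq> Pow (pverts G)"
    by (auto simp: independent_dominating_set_def independent_set_def)
  have finD: "finite ?D" and finI: "finite {S. independent_set G S}"
    using finite_subset[OF subs(1)] finite_subset[OF subs(2)] fin by simp_all
  \<comment> \<open>This ensures that the grouping loses no set; sizes in the interval that no set
    attains contribute zero.\<close>
  have range: "card ` ?D \<subseteq> ?I"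
  proof
    fix k assume "k \<in> card ` ?D"
    then obtain S where S: "independent_dominating_set G S" "k = card S" by auto
    have "Min (card ` ?D) \<le> k" using finD S by (intro Min_le) auto
    moreover have "k \<le> Max (card ` {S. independent_set G S})"
      using finI S by (intro Max_ge) (auto simp: independent_dominating_set_def)
    ultimately show "k \<in> ?I"
      unfolding independent_domination_number_def independence_number_def setcompr_eq_image by simp
  qed
  have "(\<Sum>S\<in>?D. Polynomial.monom (1::int) (card S)) =
      (\<Sum>k\<in>?I. \<Sum>S | S \<in> ?D \<and> card S = k. Polynomial.monom 1 (card S))"
    by (rule sum.group[symmetric]) (simp_all only: finD range finite_atLeastAtMost)
  also have "\<dots> = (\<Sum>k\<in>?I. Polynomial.monom (int (num_independent_dominating_sets G k)) k)"
  proof (rule sum.cong[OF refl])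
    fix k
    have "(\<Sum>S | S \<in> ?D \<and> card S = k. Polynomial.monom (1::int) (card S)) =
        (\<Sum>S | S \<in> ?D \<and> card S = k. Polynomial.monom 1 k)"
      by (rule sum.cong) auto
    also have "\<dots> = of_nat (card {S. S \<in> ?D \<and> card S = k}) * Polynomial.monom 1 k"
      by (rule sum_constant)
    also have "\<dots> = Polynomial.monom (int (num_independent_dominating_sets G k)) k"
      by (simp only: of_nat_mult_monom num_independent_dominating_sets_def mem_Collect_eq)
    finally show "(\<Sum>S | S \<in> ?D \<and> card S = k. Polynomial.monom (1::int) (card S)) =
        Polynomial.monom (int (num_independent_dominating_sets G k)) k" .
  qed
  finally show ?thesis by (simp add: independent_domination_poly_def)
qed

section \<open>Adjacency, units and common prime divisors modulo \<open>n\<close>\<close>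

abbreviation (input) comaximal_graph_mod :: "nat \<Rightarrow> int pair_pre_digraph" where
  "comaximal_graph_mod n \<equiv> comaximal_graph (residue_ring (int n))"

lemma pverts_comaximal_graph_mod: "pverts (comaximal_graph_mod n) = {0..<int n}"
  by (auto simp: comaximal_graph_def residue_ring_def)

text \<open>The two ideals span the ring iff their sum contains 1. By Bezout the integer
  combinations of \<open>a\<close> and \<open>b\<close> are the multiples of \<open>gcd a b\<close>,
  so 1 is reached modulo \<open>n\<close> iff this gcd is invertible modulo
  \<open>n\<close>.\<close>

lemma parcs_comaximal_graph_mod:
  assumes n: "n > 1"
  shows "(a, b) \<in> parcs (comaximal_graph_mod n) \<longleftrightarrow>
    a \<in> {0..<int n} \<and> b \<in> {0..<int n} \<and> a \<noteq> b \<and> coprime (gcd a b) (int n)"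
proof -
  let ?R = "residue_ring (int n)"
  interpret residues "int n" ?R using n by unfold_locales simp_all
  have carr: "carrier ?R = {0..<int n}" by (auto simp: residue_ring_def)
  have "PIdl\<^bsub>?R\<^esub> a <+>\<^bsub>?R\<^esub> PIdl\<^bsub>?R\<^esub> b = carrier ?R \<longleftrightarrow> coprime (gcd a b) (int n)"
    if a: "a \<in> carrier ?R" and b: "b \<in> carrier ?R"
  proof
    assume "PIdl\<^bsub>?R\<^esub> a <+>\<^bsub>?R\<^esub> PIdl\<^bsub>?R\<^esub> b = carrier ?R"
    then have "\<one>\<^bsub>?R\<^esub> \<in> PIdl\<^bsub>?R\<^esub> a <+>\<^bsub>?R\<^esub> PIdl\<^bsub>?R\<^esub> b" by simp
    then obtain x y where "1 = (x * a mod int n + y * b mod int n) mod int n"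
      by (auto simp: set_add_def' cgenideal_def res_add_eq res_mult_eq res_one_eq)
    then have eq: "(x * a + y * b) mod int n = 1" by (simp add: mod_simps)
    show "coprime (gcd a b) (int n)"
    proof (rule coprimeI)
      fix d assume d: "d dvd gcd a b" "d dvd int n"
      then have "d dvd x * a + y * b" by simp
      \<comment> \<open>As \<open>d\<close> also divides \<open>n\<close>, divisibility by
        \<open>d\<close> survives the reduction modulo \<open>n\<close>.\<close>
      then have "d dvd (x * a + y * b) mod int n" using d(2) by (simp add: dvd_mod)
      then show "is_unit d" by (simp add: eq)
    qed
  next
    assume cop: "coprime (gcd a b) (int n)"
    obtain u v where uv: "u * a + v * b = gcd a b" using bezout_int by blast
    \<comment> \<open>\<open>w\<close> inverts the gcd modulo \<open>n\<close>. Scaling the Bezout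
      coefficients by \<open>w\<close> yields 1; they are then reduced modulo \<open>n\<close> to
      become ring elements.\<close>
    obtain w where "[gcd a b * w = 1] (mod int n)"
      using cong_solve_coprime_int[OF cop] by blast
    moreover have "gcd a b * w = w * u * a + w * v * b"
      unfolding uv[symmetric] by (simp add: algebra_simps)
    ultimately have "((w * u mod int n) * a mod int n + (w * v mod int n) * b mod int n) mod int n = 1"
      using n by (simp add: cong_def mod_simps)
    moreover have "w * u mod int n \<in> carrier ?R" "w * v mod int n \<in> carrier ?R"
      using n by (simp_all add: carr)
    ultimately have "\<one>\<^bsub>?R\<^esub> \<in> PIdl\<^bsub>?R\<^esub> a <+>\<^bsub>?R\<^esub> PIdl\<^bsub>?R\<^esub> b"
      unfolding set_add_def' cgenideal_def res_add_eq res_mult_eq res_one_eq UN_iff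
      by (intro bexI[of _ "(w * u mod int n) * a mod int n"] bexI[of _ "(w * v mod int n) * b mod int n"])
        auto
    then show "PIdl\<^bsub>?R\<^esub> a <+>\<^bsub>?R\<^esub> PIdl\<^bsub>?R\<^esub> b = carrier ?R"
      using a b by (intro ideal.one_imp_carrier add_ideals cgenideal_ideal)
  qed
  then show ?thesis
    unfolding carr[symmetric] comaximal_graph_def pair_pre_digraph.simps mem_Collect_eq prod.case
    by blast
qed

text \<open>A prime dividing \<open>x\<close>, \<open>y\<close> and \<open>n\<close> divides both
  \<open>gcd x y\<close> and \<open>n\<close>, which rules out an arc.\<close>

lemma independent_set_comaximal_graph_mod_dvdI:
  assumes "n > 1" "S \<subseteq> {0..<int n}"
    and "\<And>x y. x \<in> S \<Longrightarrow> y \<in> S \<Longrightarrow> \<exists>p. prime p \<and> p dvd n \<and> int p dvd x \<and> int p dvd y"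
  shows "independent_set (comaximal_graph_mod n) S"
  unfolding independent_set_def pverts_comaximal_graph_mod parcs_comaximal_graph_mod[OF assms(1)]
proof (intro conjI ballI notI; (elim conjE)?)
  fix x y assume xy: "x \<in> S" "y \<in> S" and cop: "coprime (gcd x y) (int n)"
  obtain p where "prime p" "p dvd n" "int p dvd x" "int p dvd y" using assms(3)[OF xy] by blast
  then have "int p dvd 1"
    by (intro coprime_common_divisor[OF cop]) (simp_all add: int_dvd_int_iff)
  then show False using \<open>prime p\<close> by simp
qed (use assms in auto)

text \<open>For distinct \<open>x\<close> and \<open>y\<close> the missing arc yields a common
  divisor with \<open>n\<close>. For \<open>x = y\<close> the arc is missing anyway, and the
  assumption that \<open>x\<close> is a non-unit supplies the divisor.\<close>

lemma independent_set_comaximal_graph_mod_dvdE: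
  assumes "n > 1" "independent_set (comaximal_graph_mod n) S" "x \<in> S" "y \<in> S" "\<not> coprime x (int n)"
  obtains p where "prime p" "p dvd n" "int p dvd x" "int p dvd y"
proof -
  have "x \<in> {0..<int n}" "y \<in> {0..<int n}" "(x, y) \<notin> parcs (comaximal_graph_mod n)"
    using assms by (auto simp: independent_set_def pverts_comaximal_graph_mod)
  then have "\<not> coprime (gcd x y) (int n)"
    using assms(5) parcs_comaximal_graph_mod[OF assms(1)] by (cases "x = y") auto
  then obtain c where c: "c dvd gcd x y" "c dvd int n" "\<not> is_unit c"
    by (rule not_coprimeE)
  have "c \<noteq> 0" using c(2) assms(1) by auto
  then obtain p where p: "p dvd c" "prime p" using c(3) prime_divisor_exists by blast
  then obtain q where q: "p = int q" using prime_ge_0_int zero_le_imp_eq_int by blast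
  have "int q dvd gcd x y" "int q dvd int n"
    using dvd_trans[OF p(1) c(1)] dvd_trans[OF p(1) c(2)] unfolding q by simp_all
  then show ?thesis using p(2) unfolding q by (intro that[of q]) simp_all
qed

text \<open>Since \<open>gcd v u\<close> divides the unit \<open>u\<close>, it is coprime to
  \<open>n\<close>. Hence \<open>u\<close> dominates everything alone and tolerates no companion in
  an independent set.\<close>

lemma independent_dominating_set_unit_iff:
  assumes n: "n > 1" and u: "u \<in> {0..<int n}" "coprime u (int n)" "u \<in> S"
  shows "independent_dominating_set (comaximal_graph_mod n) S \<longleftrightarrow> S = {u}"
proof -
  have adj: "(v, u) \<in> parcs (comaximal_graph_mod n)" if "v \<in> {0..<int n}" "v \<noteq> u" for v
  proof -
    have "coprime (gcd v u) (int n)" using u(2) by (rule coprime_divisors[rotated 2]) simp_all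
    then show ?thesis using that u(1) by (simp add: parcs_comaximal_graph_mod[OF n])
  qed
  have "independent_dominating_set (comaximal_graph_mod n) {u}"
    using u adj by (auto simp: independent_dominating_set_def independent_set_def dominating_set_def
        pverts_comaximal_graph_mod parcs_comaximal_graph_mod[OF n])
  moreover have "S = {u}" if "independent_dominating_set (comaximal_graph_mod n) S"
    using that adj u(3) unfolding independent_dominating_set_def independent_set_def
      pverts_comaximal_graph_mod by blast
  ultimately show ?thesis by blast
qed

text \<open>Residues run over 0 to \<open>n - 1\<close> but totatives over 1 to \<open>n\<close>.
  For \<open>n > 1\<close> neither 0 nor \<open>n\<close> is coprime to \<open>n\<close>, so the two
  sets agree.\<close>

lemma card_units_mod:
  assumes "n > 1"
  shows "card {u \<in> {0..<int n}. coprime u (int n)} = totient n"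
proof -
  have "{u \<in> {0..<int n}. coprime u (int n)} = int ` totatives n"
  proof (intro Set.set_eqI iffI)
    fix u assume u: "u \<in> {u \<in> {0..<int n}. coprime u (int n)}"
    then have "u \<noteq> 0" using assms by (auto intro: ccontr)
    then show "u \<in> int ` totatives n"
      using u by (intro image_eqI[of _ _ "nat u"]) (auto simp: in_totatives_iff coprime_int_iff[symmetric])
  next
    fix u assume "u \<in> int ` totatives n"
    then show "u \<in> {u \<in> {0..<int n}. coprime u (int n)}"
      using assms totatives_less by (auto simp: in_totatives_iff)
  qed
  then show ?thesis by (simp add: card_image totient_def)
qed

definition nonunit_independent_dominating_sets :: "nat \<Rightarrow> int set set" where
  "nonunit_independent_dominating_sets n =
     {S. independent_dominating_set (comaximal_graph_mod n) S \<and> (\<forall>x\<in>S. \<not> coprime x (int n))}"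

text \<open>The singletons of units give the linear term; what remains is to classify the sets
  consisting of non-units.\<close>

lemma independent_domination_poly_comaximal_graph_mod:
  assumes n: "n > 1"
  shows "independent_domination_poly (comaximal_graph_mod n) =
    Polynomial.monom (int (totient n)) 1 +
    (\<Sum>S\<in>nonunit_independent_dominating_sets n. Polynomial.monom 1 (card S))"
proof -
  let ?G = "comaximal_graph_mod n"
  let ?U = "{u \<in> {0..<int n}. coprime u (int n)}"
  let ?N = "{S. independent_dominating_set ?G S \<and> (\<forall>x\<in>S. \<not> coprime x (int n))}"
  have sub: "S \<subseteq> {0..<int n}" if "independent_dominating_set ?G S" for S
    using that by (auto simp: independent_dominating_set_def independent_set_def pverts_comaximal_graph_mod)
  then have finN: "finite ?N" by (intro finite_subset[of ?N "Pow {0..<int n}"]) auto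
  have finU: "finite ?U" by (rule finite_subset[of _ "{0..<int n}"]) auto
  have "{S. independent_dominating_set ?G S} = (\<lambda>u. {u}) ` ?U \<union> ?N"
  proof (intro Set.set_eqI iffI)
    fix S assume "S \<in> {S. independent_dominating_set ?G S}"
    then show "S \<in> (\<lambda>u. {u}) ` ?U \<union> ?N"
      using sub[of S] independent_dominating_set_unit_iff[OF n, of _ S] by blast
  next
    fix S assume "S \<in> (\<lambda>u. {u}) ` ?U \<union> ?N"
    then show "S \<in> {S. independent_dominating_set ?G S}"
      using independent_dominating_set_unit_iff[OF n] by blast
  qed
  then have "independent_domination_poly ?G =
      (\<Sum>S\<in>(\<lambda>u. {u}) ` ?U \<union> ?N. Polynomial.monom 1 (card S))"
    by (simp add: independent_domination_poly_eq_sum pverts_comaximal_graph_mod)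
  also have "\<dots> = (\<Sum>S\<in>(\<lambda>u. {u}) ` ?U. Polynomial.monom 1 (card S)) +
      (\<Sum>S\<in>?N. Polynomial.monom 1 (card S))"
    by (intro sum.union_disjoint finite_imageI finU finN) auto
  also have "(\<Sum>S\<in>(\<lambda>u. {u}) ` ?U. Polynomial.monom (1::int) (card S)) = of_nat (card ?U) * Polynomial.monom 1 1"
    by (subst sum.reindex) (auto simp: inj_on_def)
  also have "\<dots> = Polynomial.monom (int (totient n)) 1"
    by (simp only: card_units_mod[OF n] of_nat_mult_monom)
  finally show ?thesis by (simp only: nonunit_independent_dominating_sets_def)
qed

section \<open>Residues divisible by a fixed number\<close>

definition multiples_mod :: "nat \<Rightarrow> nat \<Rightarrow> int set" where
  "multiples_mod n d = {x \<in> {0..<int n}. int d dvd x}"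

lemma finite_multiples_mod [simp]: "finite (multiples_mod n d)"
  by (rule finite_subset[of _ "{0..<int n}"]) (auto simp: multiples_mod_def)

text \<open>With the modulus written as \<open>d * k\<close>, the multiples are \<open>d * i\<close>
  for \<open>i < k\<close>, and no division occurs.\<close>

lemma card_multiples_mod:
  assumes "d > 0"
  shows "card (multiples_mod (d * k) d) = k"
proof -
  have "multiples_mod (d * k) d = (\<lambda>i. int d * int i) ` {..<k}"
  proof (intro Set.set_eqI iffI)
    fix x assume "x \<in> multiples_mod (d * k) d"
    then obtain y where y: "x = int d * y" "0 \<le> int d * y" "int d * y < int d * int k"
      by (auto simp: multiples_mod_def)
    then have "0 \<le> y" "y < int k" using assms by (auto simp: zero_le_mult_iff)
    then show "x \<in> (\<lambda>i. int d * int i) ` {..<k}"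
      using y(1) by (intro image_eqI[of _ _ "nat y"]) auto
  next
    fix x assume "x \<in> (\<lambda>i. int d * int i) ` {..<k}"
    then show "x \<in> multiples_mod (d * k) d" using assms by (auto simp: multiples_mod_def)
  qed
  then show ?thesis using assms by (simp add: card_image inj_on_def)
qed

text \<open>The gcd is 1, hence coprime to every \<open>k\<close>; the lemma is applied with the
  modulus for \<open>k\<close>.\<close>

lemma coprime_prime_gcdI:
  assumes "prime p" "\<not> int p dvd v"
  shows "coprime (gcd v (int p)) k"
proof -
  have "coprime (int p) v" using assms by (simp add: prime_imp_coprime)
  then show ?thesis by (simp add: coprime_iff_gcd_eq_1 gcd.commute)
qed

text \<open>The vertex \<open>p\<close> alone dominates the outside: a residue not divisible by
  \<open>p\<close> has gcd 1 with it. The bound \<open>p < n\<close> makes \<open>p\<close> itself a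
  residue.\<close>

lemma independent_dominating_set_multiples_mod:
  assumes n: "n > 1" and p: "prime p" "p dvd n" "p < n"
  shows "independent_dominating_set (comaximal_graph_mod n) (multiples_mod n p)"
proof -
  have "independent_set (comaximal_graph_mod n) (multiples_mod n p)"
    using p by (intro independent_set_comaximal_graph_mod_dvdI[OF n]) (auto simp: multiples_mod_def)
  moreover have "dominating_set (comaximal_graph_mod n) (multiples_mod n p)"
    unfolding dominating_set_def pverts_comaximal_graph_mod
  proof (intro conjI ballI)
    have p_in: "int p \<in> multiples_mod n p" using p by (simp add: multiples_mod_def)
    then show "multiples_mod n p \<noteq> {}" by blast
    fix v assume v: "v \<in> {0..<int n} - multiples_mod n p"
    then have "\<not> int p dvd v" by (simp add: multiples_mod_def)
    then have "(v, int p) \<in> parcs (comaximal_graph_mod n)"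
      using v p coprime_prime_gcdI[OF p(1)] by (auto simp: parcs_comaximal_graph_mod[OF n])
    then show "\<exists>s\<in>multiples_mod n p. (v, s) \<in> parcs (comaximal_graph_mod n)" using p_in by blast
  qed (auto simp: multiples_mod_def)
  ultimately show ?thesis by (simp add: independent_dominating_set_def)
qed

lemma multiples_mod_not_coprime:
  assumes "prime p" "p dvd n" "x \<in> multiples_mod n p"
  shows "\<not> coprime x (int n)"
  using assms coprime_common_divisor[of x "int n" "int p"] by (auto simp: multiples_mod_def)

text \<open>This reduces questions about products of distinct primes to propositional logic on
  divisibility by single primes.\<close>

lemma mem_multiples_mod_mult:
  assumes "coprime p q"
  shows "x \<in> multiples_mod n (p * q) \<longleftrightarrow> x \<in> multiples_mod n p \<and> x \<in> multiples_mod n q"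
proof -
  have "int p * int q dvd x \<longleftrightarrow> int p dvd x \<and> int q dvd x"
    using assms by (auto intro: divides_mult dvd_mult_left dvd_mult_right)
  then show ?thesis by (auto simp: multiples_mod_def)
qed

text \<open>These bounds guarantee that the primes and their pairwise products are vertices, so that
  they can serve as witnesses.\<close>

lemma mult_three_le_imp_less:
  fixes p q r n :: nat
  assumes gt: "p > 1" "q > 1" "r > 1" and le: "p * q * r \<le> n"
  shows "p * q < n" "p * r < n" "q * r < n" "p < n" "q < n" "r < n"
proof -
  have "p * q < p * q * r" "p * r < p * q * r" "q * r < p * q * r"
    using gt mult_strict_left_mono[of 1 r "p * q"] mult_strict_left_mono[of 1 q "p * r"]
      mult_strict_left_mono[of 1 p "q * r"] by (simp_all add: ac_simps)
  then show lt: "p * q < n" "p * r < n" "q * r < n" using le by (simp_all only: less_le_trans)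
  have "p * 1 < p * q" "1 * q < p * q" "1 * r < p * r"
    using gt by (intro mult_strict_left_mono mult_strict_right_mono; simp)+
  then show "p < n" "q < n" "r < n" using lt by linarith+
qed

section \<open>Classification of the sets of non-units for one, two and three primes\<close>

text \<open>By maximality, a set contained in a member of \<open>F\<close> equals that member. So
  covering each set by some member of \<open>F\<close> suffices.\<close>

lemma nonunit_independent_dominating_sets_eqI:
  assumes "\<And>T. T \<in> F \<Longrightarrow> T \<in> nonunit_independent_dominating_sets n"
    and "\<And>S. S \<in> nonunit_independent_dominating_sets n \<Longrightarrow> \<exists>T\<in>F. S \<subseteq> T"
  shows "nonunit_independent_dominating_sets n = F"
proof (intro Set.set_eqI iffI)
  fix S assume S: "S \<in> nonunit_independent_dominating_sets n"
  then obtain T where T: "T \<in> F" "S \<subseteq> T" using assms(2) by blast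
  have "S = T"
    using S assms(1)[OF T(1)] T(2)
    by (intro independent_dominating_set_maximal[of "comaximal_graph_mod n"])
      (simp_all add: nonunit_independent_dominating_sets_def independent_dominating_set_def)
  then show "S \<in> F" using T(1) by simp
qed (rule assms(1))

lemma multiples_mod_in_nonunit_independent_dominating_sets:
  assumes "n > 1" "prime p" "p dvd n" "p < n"
  shows "multiples_mod n p \<in> nonunit_independent_dominating_sets n"
  using assms independent_dominating_set_multiples_mod multiples_mod_not_coprime
  unfolding nonunit_independent_dominating_sets_def by blast

text \<open>This is the intersecting property in terms of prime divisors of \<open>n\<close>; it
  includes the case \<open>x = y\<close>.\<close>

lemma nonunit_common_prime:
  assumes "n > 1" "S \<in> nonunit_independent_dominating_sets n" "x \<in> S" "y \<in> S"
  shows "\<exists>p\<in>prime_factors n. x \<in> multiples_mod n p \<and> y \<in> multiples_mod n p"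
proof -
  have S: "independent_set (comaximal_graph_mod n) S" and nu: "\<not> coprime x (int n)"
    using assms(2,3) by (simp_all add: nonunit_independent_dominating_sets_def independent_dominating_set_def)
  obtain p where "prime p" "p dvd n" "int p dvd x" "int p dvd y"
    using independent_set_comaximal_graph_mod_dvdE[OF assms(1) S assms(3,4) nu] by blast
  moreover have "x \<in> {0..<int n}" "y \<in> {0..<int n}"
    using S assms(3,4) by (auto simp: independent_set_def pverts_comaximal_graph_mod)
  ultimately show ?thesis using assms(1) by (auto simp: multiples_mod_def in_prime_factors_iff)
qed

lemma nonunit_independent_dominating_sets_one_prime:
  assumes pf: "prime_factors n = {p}" and "p < n"
  shows "nonunit_independent_dominating_sets n = {multiples_mod n p}"
proof (rule nonunit_independent_dominating_sets_eqI)
  have "p \<in> prime_factors n" by (simp add: pf)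
  then have p: "prime p" "p dvd n" by auto
  then have n: "n > 1" using \<open>p < n\<close> prime_gt_1_nat[of p] by linarith
  show "T \<in> nonunit_independent_dominating_sets n" if "T \<in> {multiples_mod n p}" for T
    using that p n \<open>p < n\<close> multiples_mod_in_nonunit_independent_dominating_sets by blast
  show "\<exists>T\<in>{multiples_mod n p}. S \<subseteq> T" if "S \<in> nonunit_independent_dominating_sets n" for S
    using nonunit_common_prime[OF n that] unfolding pf by blast
qed

text \<open>If \<open>S\<close> lay in neither set, an element not divisible by \<open>p\<close> and
  one not divisible by \<open>q\<close> would share no prime of \<open>n\<close>.\<close>

lemma nonunit_independent_dominating_sets_two_primes:
  assumes pf: "prime_factors n = {p, q}" and "p < n" "q < n"
  shows "nonunit_independent_dominating_sets n = {multiples_mod n p, multiples_mod n q}"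
proof (rule nonunit_independent_dominating_sets_eqI)
  have "p \<in> prime_factors n" "q \<in> prime_factors n" by (simp_all add: pf)
  then have pq: "prime p" "p dvd n" "prime q" "q dvd n" by auto
  then have n: "n > 1" using \<open>p < n\<close> prime_gt_1_nat[of p] by linarith
  show "T \<in> nonunit_independent_dominating_sets n" if "T \<in> {multiples_mod n p, multiples_mod n q}" for T
    using that pq n assms(2,3) multiples_mod_in_nonunit_independent_dominating_sets by blast
  show "\<exists>T\<in>{multiples_mod n p, multiples_mod n q}. S \<subseteq> T"
    if S: "S \<in> nonunit_independent_dominating_sets n" for S
  proof (rule ccontr)
    assume "\<not> ?thesis"
    then have "\<not> S \<subseteq> multiples_mod n p" "\<not> S \<subseteq> multiples_mod n q" by simp_all
    then obtain x y where xy: "x \<in> S" "x \<notin> multiples_mod n p" "y \<in> S" "y \<notin> multiples_mod n q"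
      unfolding subset_iff by blast
    show False using nonunit_common_prime[OF n S xy(1,3)] xy(2,4) unfolding pf by simp
  qed
qed

text \<open>The first set consists of the residues divisible by at least two of the primes. It is
  independent because two pairs chosen from three primes always meet.\<close>

lemma nonunit_independent_dominating_sets_three_primes:
  assumes pf: "prime_factors n = {p, q, r}" and ne: "p \<noteq> q" "p \<noteq> r" "q \<noteq> r"
  shows "nonunit_independent_dominating_sets n =
    {multiples_mod n (p * q) \<union> multiples_mod n (p * r) \<union> multiples_mod n (q * r),
     multiples_mod n p, multiples_mod n q, multiples_mod n r}" (is "_ = ?F")
proof (rule nonunit_independent_dominating_sets_eqI)
  let ?M = "multiples_mod n"
  let ?T = "?M (p * q) \<union> ?M (p * r) \<union> ?M (q * r)"
  have "p \<in> prime_factors n" "q \<in> prime_factors n" "r \<in> prime_factors n" by (simp_all add: pf)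
  then have pr: "prime p" "p dvd n" "prime q" "q dvd n" "prime r" "r dvd n" and n0: "n > 0"
    by (auto intro: Nat.gr0I)
  have cop: "coprime p q" "coprime p r" "coprime q r" using pr ne primes_coprime by blast+
  note mem = cop[THEN mem_multiples_mod_mult]
  have "p * q * r dvd n" using pr cop by (simp add: divides_mult)
  then have le: "p * q * r \<le> n" using n0 by (rule dvd_imp_le)
  have gt: "p > 1" "q > 1" "r > 1" using pr prime_gt_1_nat by blast+
  note lt = mult_three_le_imp_less(1-3)[OF gt le] and lt1 = mult_three_le_imp_less(4-6)[OF gt le]
  then have n: "n > 1" using gt by linarith
  have T: "?T \<in> nonunit_independent_dominating_sets n"
  proof -
    have "independent_set (comaximal_graph_mod n) ?T"
    proof (rule independent_set_comaximal_graph_mod_dvdI[OF n])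
      show "?T \<subseteq> {0..<int n}" by (auto simp: multiples_mod_def)
      fix x y assume "x \<in> ?T" "y \<in> ?T"
      then have "\<exists>s\<in>{p, q, r}. x \<in> ?M s \<and> y \<in> ?M s" unfolding Un_iff mem by blast
      then show "\<exists>s. prime s \<and> s dvd n \<and> int s dvd x \<and> int s dvd y"
        using pr unfolding multiples_mod_def by blast
    qed
    moreover have "dominating_set (comaximal_graph_mod n) ?T"
      unfolding dominating_set_def pverts_comaximal_graph_mod
    proof (intro conjI ballI)
      \<comment> \<open>The three pairwise products will be the dominating vertices.\<close>
      have in_T: "int (p * q) \<in> ?T" "int (p * r) \<in> ?T" "int (q * r) \<in> ?T"
        using lt by (simp_all add: multiples_mod_def flip: of_nat_mult)
      then show "?T \<noteq> {}" by blast
      fix v assume v: "v \<in> {0..<int n} - ?T"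
      \<comment> \<open>A residue divisible by neither \<open>s\<close> nor \<open>t\<close> has gcd
        1 with \<open>s * t\<close>; it differs from that product because it lies outside the
        set.\<close>
      have adj: "(v, int (s * t)) \<in> parcs (comaximal_graph_mod n)"
        if st: "prime s" "prime t" "v \<notin> ?M s" "v \<notin> ?M t" "s * t < n" "int (s * t) \<in> ?T" for s t
      proof -
        have "\<not> int s dvd v" "\<not> int t dvd v" using v st(3,4) by (auto simp: multiples_mod_def)
        then have "coprime v (int s)" "coprime v (int t)"
          using st(1,2) by (simp_all add: coprime_commute[of v] prime_imp_coprime)
        then have "gcd v (int (s * t)) = 1" by (simp flip: coprime_iff_gcd_eq_1)
        then have "coprime (gcd v (int (s * t))) (int n)" by simp
        moreover have "v \<noteq> int (s * t)" using v st(6) by blast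
        moreover have "int (s * t) \<in> {0..<int n}" using st(5) by (simp flip: of_nat_mult)
        ultimately show ?thesis using v by (simp only: parcs_comaximal_graph_mod[OF n]) blast
      qed
      \<comment> \<open>Outside the set, \<open>v\<close> is divisible by at most one of the primes,
        so it misses some two of them.\<close>
      consider "v \<notin> ?M p" "v \<notin> ?M q" | "v \<notin> ?M p" "v \<notin> ?M r" | "v \<notin> ?M q" "v \<notin> ?M r"
        using v unfolding Diff_iff Un_iff mem by blast
      then show "\<exists>s\<in>?T. (v, s) \<in> parcs (comaximal_graph_mod n)"
      proof cases
        case 1
        then show ?thesis using adj[OF pr(1,3) _ _ lt(1) in_T(1)] in_T(1) by blast
      next
        case 2
        then show ?thesis using adj[OF pr(1,5) _ _ lt(2) in_T(2)] in_T(2) by blast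
      next
        case 3
        then show ?thesis using adj[OF pr(3,5) _ _ lt(3) in_T(3)] in_T(3) by blast
      qed
    qed (auto simp: multiples_mod_def)
    moreover have "\<forall>x\<in>?T. \<not> coprime x (int n)"
    proof
      fix x assume "x \<in> ?T"
      then have "x \<in> ?M p \<or> x \<in> ?M q" unfolding Un_iff mem by blast
      then show "\<not> coprime x (int n)"
        using multiples_mod_not_coprime[OF pr(1,2)] multiples_mod_not_coprime[OF pr(3,4)] by blast
    qed
    ultimately show ?thesis
      by (simp only: nonunit_independent_dominating_sets_def independent_dominating_set_def) blast
  qed
  show "S \<in> nonunit_independent_dominating_sets n" if "S \<in> ?F" for S
    using that T pr n lt1 multiples_mod_in_nonunit_independent_dominating_sets by blast
  show "\<exists>T\<in>?F. S \<subseteq> T" if S: "S \<in> nonunit_independent_dominating_sets n" for S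
  proof (cases "S \<subseteq> ?M p \<or> S \<subseteq> ?M q \<or> S \<subseteq> ?M r")
    case False
    then obtain x y z where xyz: "x \<in> S" "x \<notin> ?M p" "y \<in> S" "y \<notin> ?M q" "z \<in> S" "z \<notin> ?M r"
      unfolding subset_iff by blast
    \<comment> \<open>Each of \<open>x\<close>, \<open>y\<close>, \<open>z\<close> avoids one prime.
      Sharing a prime with each forces \<open>w\<close> to be divisible by a member of every pair of
      primes, hence by at least two primes.\<close>
    have "S \<subseteq> ?T"
    proof
      fix w assume w: "w \<in> S"
      have "w \<in> ?M q \<or> w \<in> ?M r"
        using nonunit_common_prime[OF n S w xyz(1)] xyz(2) unfolding pf by auto
      moreover have "w \<in> ?M p \<or> w \<in> ?M r"
        using nonunit_common_prime[OF n S w xyz(3)] xyz(4) unfolding pf by auto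
      moreover have "w \<in> ?M p \<or> w \<in> ?M q"
        using nonunit_common_prime[OF n S w xyz(5)] xyz(6) unfolding pf by auto
      ultimately show "w \<in> ?T" unfolding Un_iff mem by blast
    qed
    then show ?thesis by blast
  qed blast
qed

section \<open>Cardinalities and the resulting polynomials\<close>

text \<open>Inclusion-exclusion: the three sets have \<open>k * r\<close>, \<open>k * q\<close> and
  \<open>k * p\<close> elements. Each of the two successive unions overlaps in exactly the
  \<open>k\<close> multiples of \<open>p * q * r\<close>, which accounts for the 2.\<close>

lemma card_multiples_mod_two_of_three:
  fixes p q r :: nat
  assumes cop: "coprime p q" "coprime p r" "coprime q r" and pos: "p > 0" "q > 0" "r > 0"
    and n: "n = k * (p * q * r)"
  shows "card (multiples_mod n (p * q) \<union> multiples_mod n (p * r) \<union> multiples_mod n (q * r)) =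
    k * (p + q + r - 2)"
proof -
  let ?M = "multiples_mod n"
  have cop': "coprime (p * q) r" using cop by simp
  note mem = cop[THEN mem_multiples_mod_mult] cop'[THEN mem_multiples_mod_mult]
  have c: "card (?M (p * q)) = k * r" "card (?M (p * r)) = k * q" "card (?M (q * r)) = k * p"
    "card (?M (p * q * r)) = k"
    using card_multiples_mod[of "p * q" "k * r"] card_multiples_mod[of "p * r" "k * q"]
      card_multiples_mod[of "q * r" "k * p"] card_multiples_mod[of "p * q * r" k] pos
    by (simp_all add: n ac_simps)
  have i: "?M (p * q) \<inter> ?M (p * r) = ?M (p * q * r)"
    "(?M (p * q) \<union> ?M (p * r)) \<inter> ?M (q * r) = ?M (p * q * r)"
    by (intro Set.set_eqI, unfold Int_iff Un_iff mem, blast)+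
  \<comment> \<open>The counts are stated additively to avoid truncated subtraction.\<close>
  have "card (?M (p * q) \<union> ?M (p * r)) + k = k * r + k * q"
    using card_Un_Int[of "?M (p * q)" "?M (p * r)"] by (simp add: i c)
  moreover have "card (?M (p * q) \<union> ?M (p * r) \<union> ?M (q * r)) + k =
      card (?M (p * q) \<union> ?M (p * r)) + k * p"
    using card_Un_Int[of "?M (p * q) \<union> ?M (p * r)" "?M (q * r)"] by (simp add: i c)
  ultimately have "card (?M (p * q) \<union> ?M (p * r) \<union> ?M (q * r)) = k * r + k * q + k * p - k * 2"
    by linarith
  also have "\<dots> = k * (p + q + r - 2)" by (simp add: diff_mult_distrib2 add_mult_distrib2 ac_simps)
  finally show ?thesis .
qed

lemma independent_domination_poly_one_prime:
  fixes p m :: nat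
  assumes p: "prime p" and m: "m \<ge> 2"
  shows "independent_domination_poly (comaximal_graph_mod (p ^ m)) =
    Polynomial.monom (int p ^ m - int p ^ (m - 1)) 1 + Polynomial.monom 1 (p ^ (m - 1))"
proof -
  have p1: "p > 1" using p prime_gt_1_nat by blast
  have pm: "p ^ m = p * p ^ (m - 1)" using m by (simp flip: power_Suc)
  \<comment> \<open>Here \<open>m \<ge> 2\<close> enters: it makes \<open>p\<close> a proper divisor
    of the modulus.\<close>
  have "p ^ 1 < p ^ m" using p1 m by (intro power_strict_increasing) auto
  then have lt: "p < p ^ m" by simp
  have "prime_factors (p ^ m) = {p}" using p m by (simp add: prime_factors_power prime_prime_factors)
  then have sets: "nonunit_independent_dominating_sets (p ^ m) = {multiples_mod (p ^ m) p}"
    using lt by (rule nonunit_independent_dominating_sets_one_prime)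
  have "card (multiples_mod (p ^ m) p) = p ^ (m - 1)"
    unfolding pm using p1 by (intro card_multiples_mod) simp
  moreover have "int (totient (p ^ m)) = int p ^ m - int p ^ (m - 1)"
  proof -
    have "int (totient (p ^ m)) = int (p ^ (m - 1)) * int (p - 1)"
      using totient_prime_power[of p m] p m by simp
    also have "\<dots> = int (p ^ m) - int (p ^ (m - 1))"
      unfolding pm using p1 by (simp add: of_nat_diff algebra_simps)
    finally show ?thesis by simp
  qed
  ultimately show ?thesis
    using independent_domination_poly_comaximal_graph_mod[of "p ^ m"] lt p1
    unfolding sets by simp
qed

lemma independent_domination_poly_two_primes:
  fixes p q n1 n2 :: nat
  assumes pr: "prime p" "prime q" "p \<noteq> q" and pos: "n1 > 0" "n2 > 0"
    and n: "n = p ^ n1 * q ^ n2"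
  shows "independent_domination_poly (comaximal_graph_mod n) =
    Polynomial.monom (int (totient n)) 1 + Polynomial.monom 1 (p ^ n1 * q ^ (n2 - 1)) +
    Polynomial.monom 1 (p ^ (n1 - 1) * q ^ n2)"
proof -
  let ?M = "multiples_mod n"
  have gt: "p > 1" "q > 1" using pr prime_gt_1_nat by blast+
  have pw: "p ^ n1 = p * p ^ (n1 - 1)" "q ^ n2 = q * q ^ (n2 - 1)"
    using pos by (simp_all flip: power_Suc)
  \<comment> \<open>Splitting off one prime factor gives the shape required for counting
    multiples.\<close>
  have np: "n = p * (p ^ (n1 - 1) * q ^ n2)" and nq: "n = q * (p ^ n1 * q ^ (n2 - 1))"
    using pw by (simp_all add: n ac_simps)
  have "prime_factors n = prime_factors (p ^ n1) \<union> prime_factors (q ^ n2)"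
    unfolding n using gt by (intro prime_factors_product) auto
  then have pf: "prime_factors n = {p, q}"
    using pr pos by (auto simp: prime_factors_power prime_prime_factors)
  have n0: "n > 0" using n gt by simp
  have "coprime p q" using pr primes_coprime by blast
  then have "p * q dvd n" by (intro divides_mult dvdI[OF np] dvdI[OF nq])
  then have "p * q \<le> n" using n0 by (rule dvd_imp_le)
  moreover have "p * 1 < p * q" "1 * q < p * q"
    using gt by (intro mult_strict_left_mono mult_strict_right_mono; simp)+
  ultimately have lt: "p < n" "q < n" by linarith+
  have sets: "nonunit_independent_dominating_sets n = {?M p, ?M q}"
    using pf lt by (rule nonunit_independent_dominating_sets_two_primes)
  \<comment> \<open>The vertex \<open>p\<close> separates the two sets, so the sum over them really
    has two terms.\<close>
  have "int p \<in> ?M p" "int p \<notin> ?M q"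
    using lt pr primes_dvd_imp_eq[of q p] by (auto simp: multiples_mod_def)
  then have ne: "?M p \<noteq> ?M q" by blast
  have "card (?M p) = p ^ (n1 - 1) * q ^ n2" "card (?M q) = p ^ n1 * q ^ (n2 - 1)"
    using card_multiples_mod[of p "p ^ (n1 - 1) * q ^ n2", folded np]
      card_multiples_mod[of q "p ^ n1 * q ^ (n2 - 1)", folded nq] gt by simp_all
  then show ?thesis
    using independent_domination_poly_comaximal_graph_mod[of n] lt gt ne
    unfolding sets by simp
qed

text \<open>Here \<open>k\<close> is \<open>n\<close> divided by its radical
  \<open>p * q * r\<close>. Divisibility by these primes depends only on the residue modulo the
  radical, so every size acquires the factor \<open>k\<close>.\<close>

lemma independent_domination_poly_three_primes:
  fixes p q r n1 n2 n3 :: nat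
  assumes pr: "prime p" "prime q" "prime r" and ne: "p \<noteq> q" "p \<noteq> r" "q \<noteq> r"
    and pos: "n1 > 0" "n2 > 0" "n3 > 0"
    and n: "n = p ^ n1 * q ^ n2 * r ^ n3" and k: "k = p ^ (n1 - 1) * q ^ (n2 - 1) * r ^ (n3 - 1)"
  shows "independent_domination_poly (comaximal_graph_mod n) =
    Polynomial.monom (int (totient n)) 1 + Polynomial.monom 1 (k * (p + q + r - 2)) +
    Polynomial.monom 1 (k * (p * q)) + Polynomial.monom 1 (k * (p * r)) +
    Polynomial.monom 1 (k * (q * r))"
proof -
  let ?M = "multiples_mod n"
  let ?T = "?M (p * q) \<union> ?M (p * r) \<union> ?M (q * r)"
  have gt: "p > 1" "q > 1" "r > 1" using pr prime_gt_1_nat by blast+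
  have pw: "p ^ n1 = p * p ^ (n1 - 1)" "q ^ n2 = q * q ^ (n2 - 1)" "r ^ n3 = r * r ^ (n3 - 1)"
    using pos by (simp_all flip: power_Suc)
  have nk: "n = k * (p * q * r)" unfolding n k pw by (simp only: ac_simps)
  have k0: "k > 0" using gt by (simp add: k)
  have cop: "coprime p q" "coprime p r" "coprime q r" using pr ne primes_coprime by blast+
  have "prime_factors n = prime_factors (p ^ n1) \<union> prime_factors (q ^ n2) \<union> prime_factors (r ^ n3)"
    unfolding n using gt by (subst prime_factors_product; simp)+
  then have pf: "prime_factors n = {p, q, r}"
    using pr pos by (auto simp: prime_factors_power prime_prime_factors)
  have sets: "nonunit_independent_dominating_sets n = {?T, ?M p, ?M q, ?M r}"
    using pf ne by (rule nonunit_independent_dominating_sets_three_primes)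
  have card_M: "card (?M p) = k * (q * r)" "card (?M q) = k * (p * r)" "card (?M r) = k * (p * q)"
    using card_multiples_mod[of p "k * (q * r)"] card_multiples_mod[of q "k * (p * r)"]
      card_multiples_mod[of r "k * (p * q)"] gt by (simp_all add: nk ac_simps)
  have card_T: "card ?T = k * (p + q + r - 2)"
    using cop gt nk by (intro card_multiples_mod_two_of_three) simp_all
  have le: "p * q * r \<le> n" using k0 by (simp add: nk)
  note lt = mult_three_le_imp_less(1-3)[OF gt le] and lt1 = mult_three_le_imp_less(4-6)[OF gt le]
  have nd: "\<not> p dvd q" "\<not> q dvd p" "\<not> p dvd r" "\<not> r dvd p" "\<not> q dvd r" "\<not> r dvd q"
    using pr ne primes_dvd_imp_eq by blast+
  have in_M: "int s \<in> ?M t \<longleftrightarrow> t dvd s" if "s < n" for s t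
    using that by (simp add: multiples_mod_def)
  note mem = cop[THEN mem_multiples_mod_mult]
  \<comment> \<open>Each prime lies in its own set of multiples and in none of the other three sets;
    this makes the four sets pairwise distinct.\<close>
  have "int p \<notin> ?T" "int q \<notin> ?T" "int r \<notin> ?T"
    unfolding Un_iff mem in_M[OF lt1(1)] in_M[OF lt1(2)] in_M[OF lt1(3)] using nd by blast+
  moreover have "int p \<in> ?M p" "int q \<in> ?M q" "int r \<in> ?M r" "int p \<notin> ?M q" "int p \<notin> ?M r" "int q \<notin> ?M r"
    using in_M lt1 nd by simp_all
  ultimately have dist: "?M p \<noteq> ?M q" "?M p \<noteq> ?M r" "?M q \<noteq> ?M r" "?T \<noteq> ?M p" "?T \<noteq> ?M q" "?T \<noteq> ?M r"
    by blast+
  have "independent_domination_poly (comaximal_graph_mod n) = Polynomial.monom (int (totient n)) 1 +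
      (\<Sum>S\<in>{?T, ?M p, ?M q, ?M r}. Polynomial.monom 1 (card S))"
    using independent_domination_poly_comaximal_graph_mod[of n] lt1 gt
    unfolding sets by simp
  also have "(\<Sum>S\<in>{?T, ?M p, ?M q, ?M r}. Polynomial.monom (1::int) (card S)) =
      Polynomial.monom 1 (card ?T) + (Polynomial.monom 1 (card (?M p)) +
        (Polynomial.monom 1 (card (?M q)) + Polynomial.monom 1 (card (?M r))))"
    using dist by simp
  finally show ?thesis unfolding card_T card_M by (simp only: ac_simps)
qed

text \<open>With three primes the exponents are products, as the set sizes are. A factor
  \<open>x^k\<close> in front of the bracket, read literally, would add \<open>k\<close> to the
  exponents instead.\<close>

theorem corollary2p5:
  fixes n :: nat
  shows
    "(\<forall>p m :: nat. prime p \<and> m \<ge> 2 \<and> n = p ^ m \<longrightarrow>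
        independent_domination_poly (comaximal_graph (residue_ring (int n))) =
          Polynomial.monom (int p ^ m - int p ^ (m - 1)) 1 + Polynomial.monom 1 (p ^ (m - 1)))
   \<and> (\<forall>p q n1 n2 :: nat. prime p \<and> prime q \<and> p < q \<and> n1 > 0 \<and> n2 > 0 \<and>
          n = p ^ n1 * q ^ n2 \<longrightarrow>
        independent_domination_poly (comaximal_graph (residue_ring (int n))) =
          Polynomial.monom (int (totient n)) 1
          + Polynomial.monom 1 (p ^ n1 * q ^ (n2 - 1))
          + Polynomial.monom 1 (p ^ (n1 - 1) * q ^ n2))
   \<and> (\<forall>p q r n1 n2 n3 :: nat. prime p \<and> prime q \<and> prime r \<and>
          p \<noteq> q \<and> p \<noteq> r \<and> q \<noteq> r \<and> n1 > 0 \<and> n2 > 0 \<and> n3 > 0 \<and>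
          n = p ^ n1 * q ^ n2 * r ^ n3 \<longrightarrow>
        independent_domination_poly (comaximal_graph (residue_ring (int n))) =
          Polynomial.monom (int (totient n)) 1
          + Polynomial.monom 1 (p ^ (n1 - 1) * q ^ (n2 - 1) * r ^ (n3 - 1) * (p + q + r - 2))
          + Polynomial.monom 1 (p ^ (n1 - 1) * q ^ (n2 - 1) * r ^ (n3 - 1) * (p * q))
          + Polynomial.monom 1 (p ^ (n1 - 1) * q ^ (n2 - 1) * r ^ (n3 - 1) * (p * r))
          + Polynomial.monom 1 (p ^ (n1 - 1) * q ^ (n2 - 1) * r ^ (n3 - 1) * (q * r)))"

  \<comment> \<open>\<open>refl\<close> instantiates the abbreviating variable \<open>k\<close> with
    the explicit product of prime powers.\<close>
  using independent_domination_poly_one_prime independent_domination_poly_two_primes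
    independent_domination_poly_three_primes[OF _ _ _ _ _ _ _ _ _ _ refl]
  by (intro conjI allI impI; (elim conjE)?) simp_all

end
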